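(* Let $\Delta^n f(s)=\sum_{\nu=0}^n(-1)^{n-\nu}\binom{n}{\nu}f(s+\nu)$ (forward difference, acting on the indicated variable). Let \[ \mathcal{H}(s)=\sum_{n\ge1}\frac{(-1)^{n+1}}{2^n}\,\Delta^n\big(x^{-s}\log x\big)\Big|_{x=1}\qquad(s\in\mathbb{C}), \] let $a_n=\frac{(-1)^{n+1}}{2^n}\Delta^n\log x|_{x=1}$ and $\mathcal{L}^\star(f)=\sum_{n\ge1}a_nf(n)$ for $f\in\mathbb{C}[x]$. For $n\ge1$ define \[ \mathfrak{p}_n(x)=\sum_{\nu=0}^n(-1)^\nu 2^{n-\nu}\binom{x+\nu}{\nu}\,\Delta^\nu (x+1)^n, \] where $\binom{x+\nu}{\nu}=\frac{(x+\nu)(x+\nu-1)\cdots(x+1)}{\nu!}$ and $\Delta^\nu$ acts on the variable $x$. Then for all $n\ge1$: \[ \mathcal{H}(-n)=2^{-n}\mathcal{L}^\star(\mathfrak{p}_n); \] $\mathfrak{p}_1(x)=x+1$, $\mathfrak{p}_2(x)=x(x+1)$; and there are polynomials $\mathfrak{q}_n$ with \[ \mathfrak{p}_n(x)=\begin{cases}(x+1)^2\,\mathfrak{q}_n(x)&\text{for odd } n\ge3,\\ x(x+1)\,\mathfrak{q}_n(x)&\text{for even } n\ge4,\end{cases} \] where $\mathfrak{p}_n,\mathfrak{q}_n\in\mathbb{Z}[x]$ are monic of degrees $n$ and $n-2$ respectively. Moreover \[ \mathfrak{p}_n(0)=\tanh^{(n)}(0)=2^{n+1}(2^{n+1}-1)\frac{B_{n+1}}{n+1}\quad(n\ge1),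 \] \[ \mathfrak{p}_n'(-1)=-\mathfrak{p}_{n-1}(0)\quad(n\ge2),\qquad \mathfrak{p}_n'(0)=(n-1)\,\mathfrak{p}_{n-1}(0)\quad(n\ge2\text{ even}). \]
   Context: $B_n$ are the Bernoulli numbers, defined by $\frac{s}{e^s-1}=\sum_{n\ge0}B_n\frac{s^n}{n!}$. $\tanh^{(n)}(0)$ is the $n$-th derivative of $\tanh$ at $0$. The series defining $\mathcal{H}(s)$ converges for all $s\in\mathbb{C}$, and the series defining $\mathcal{L}^\star(f)$ converges absolutely for every polynomial $f$. *)

theory Defs
  imports "HOL-Analysis.Analysis" "HOL-Computational_Algebra.Computational_Algebra"
begin

definition fwd_diff :: "nat \<Rightarrow> ('a::semiring_1 \<Rightarrow> 'b::comm_ring_1) \<Rightarrow> 'a \<Rightarrow> 'b" where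
  "fwd_diff n f s = (\<Sum>\<nu>\<le>n. (-1) ^ (n - \<nu>) * of_nat (n choose \<nu>) * f (s + of_nat \<nu>))"

text \<open>The series start at index 1, whence the shift by \<open>Suc\<close>.\<close>

definition cal_H :: "complex \<Rightarrow> complex" where
  "cal_H s = (\<Sum>m. let n = Suc m in
     (-1) ^ (n + 1) / 2 ^ n *
       fwd_diff n (\<lambda>x::real. complex_of_real x powr (- s) * complex_of_real (ln x)) 1)"

definition a_coeff :: "nat \<Rightarrow> real" where
  "a_coeff n = (-1) ^ (n + 1) / 2 ^ n * fwd_diff n ln (1::real)"

definition L_star :: "complex poly \<Rightarrow> complex" where
  "L_star f = (\<Sum>m. let n = Suc m in complex_of_real (a_coeff n) * poly f (of_nat n))"

definition binom_poly :: "nat \<Rightarrow> complex poly" where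
  "binom_poly \<nu> = smult (1 / fact \<nu>) (\<Prod>j=1..\<nu>. [:of_nat j, 1:])"

text \<open>The polynomial \<open>\<Delta>\<^sup>\<nu> (x + 1)\<^sup>n\<close> is obtained by applying the difference operator over the
  ring of polynomials, at the point \<open>[:0, 1:]\<close>, i.e. the indeterminate; lemma \<open>poly_pp\<close> below
  gives the values of \<open>pp n\<close> at complex numbers.\<close>

definition pp :: "nat \<Rightarrow> complex poly" where
  "pp n = (\<Sum>\<nu>\<le>n. (-1) ^ \<nu> * 2 ^ (n - \<nu>) * binom_poly \<nu> *
                   fwd_diff \<nu> (\<lambda>X. (X + 1) ^ n) [:0, 1:])"

lemma poly_binom_poly: "poly (binom_poly \<nu>) x = (x + of_nat \<nu>) gchoose \<nu>"
proof -
  have "(\<Prod>j=1..\<nu>. of_nat j + x) = (\<Prod>i=0..<\<nu>. x + of_nat \<nu> - of_nat i)"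
    by (rule prod.reindex_bij_witness[of _ "\<lambda>i. \<nu> - i" "\<lambda>j. \<nu> - j"]) (auto simp: of_nat_diff)
  then show ?thesis
    by (simp add: binom_poly_def poly_prod gbinomial_prod_rev)
qed

lemma poly_pp:
  "poly (pp n) x = (\<Sum>\<nu>\<le>n. (-1) ^ \<nu> * 2 ^ (n - \<nu>) * ((x + of_nat \<nu>) gchoose \<nu>) *
                             fwd_diff \<nu> (\<lambda>t. (t + 1) ^ n) x)"
  by (simp add: pp_def fwd_diff_def poly_sum poly_binom_poly)

text \<open>Both power series in the quotient have subdegree 1, so the division is exact.\<close>

definition bernoulli_num :: "nat \<Rightarrow> real" where
  "bernoulli_num n = fact n * fps_nth (fps_X / (fps_exp 1 - 1)) n"

definition int_coeffs :: "complex poly \<Rightarrow> bool" where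
  "int_coeffs p \<longleftrightarrow> (\<forall>i. coeff p i \<in> \<int>)"

end

theory Submission
  imports Defs "HOL-Real_Asymp.Real_Asymp"
begin

text \<open>
  Everything rests on the operator \<open>R p (x) = (x + 1) (2 p(x) - p(x + 1))\<close>. The polynomials satisfy
  \<open>p\<^sub>n\<^sub>+\<^sub>1 = R p\<^sub>n\<close>, \<open>p\<^sub>0 = 1\<close>, which gives integrality, degree and the zero at \<open>-1\<close>, and says
  that \<open>(1 + tanh t)\<^bsup>x+1\<^esup>\<close> is the exponential generating function; its value and its \<open>x\<close>-derivative
  at \<open>x = 0\<close> give the special values, and hence the second linear factor.
  On the other side, the Leibniz rule \<open>\<Delta>\<^sup>m(x f) = (x + m) \<Delta>\<^sup>m f + m \<Delta>\<^sup>m\<^sup>-\<^sup>1 f\<close> and a shift of the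
  summation index show that replacing \<open>x\<^sup>j\<^sup>+\<^sup>1 log x\<close> by \<open>x\<^sup>j log x\<close> in the series turns the weight
  \<open>p\<close> into \<open>R p / 2\<close>; iterating from weight \<open>1\<close> yields the formula for \<open>H(-n)\<close>. Convergence
  comes from \<open>\<bar>\<Delta>\<^sup>m log x\<bar> \<le> 1\<close> at \<open>x = 1\<close>.
\<close>

unbundle no vec_syntax

section \<open>Differences and the recurrence\<close>

lemma fwd_diff_0: "fwd_diff 0 f s = f s"
  by (simp add: fwd_diff_def)

text \<open>Pascal's rule splits each coefficient, and the detached index 0 completes the
  \<open>n choose Suc \<nu>\<close> part to a full sum. Later inductions on the order of a
  difference use this form.\<close>

lemma fwd_diff_Suc: "fwd_diff (Suc n) f s = fwd_diff n f (s + 1) - fwd_diff n f s"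
proof -
  let ?t = "\<lambda>k \<nu>. (-1) ^ (Suc n - \<nu>) * of_nat k * f (s + of_nat \<nu>)"
  have "fwd_diff (Suc n) f s = ?t 1 0 + (\<Sum>\<nu>\<le>n. ?t ((n choose Suc \<nu>) + (n choose \<nu>)) (Suc \<nu>))"
    unfolding fwd_diff_def by (subst sum.atMost_Suc_shift) (simp add: add.commute)
  also have "\<dots> = (?t 1 0 + (\<Sum>\<nu>\<le>n. ?t (n choose Suc \<nu>) (Suc \<nu>))) + (\<Sum>\<nu>\<le>n. ?t (n choose \<nu>) (Suc \<nu>))"
    by (simp add: algebra_simps sum.distrib)
  also have "?t 1 0 + (\<Sum>\<nu>\<le>n. ?t (n choose Suc \<nu>) (Suc \<nu>)) = (\<Sum>\<nu>\<le>Suc n. ?t (n choose \<nu>) \<nu>)"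
    by (subst sum.atMost_Suc_shift) simp
  \<comment> \<open>The larger exponent flips the sign, and the term at \<open>Suc n\<close> has
    binomial coefficient 0.\<close>
  also have "\<dots> = - fwd_diff n f s"
    by (simp add: fwd_diff_def Suc_diff_le binomial_eq_0 flip: sum_negf)
  also have "(\<Sum>\<nu>\<le>n. ?t (n choose \<nu>) (Suc \<nu>)) = fwd_diff n f (s + 1)"
    by (simp add: fwd_diff_def add.assoc)
  finally show ?thesis by simp
qed

text \<open>Leibniz rule for a linear factor, whose second difference vanishes. It drives the
  recurrence for \<open>pp\<close> (\<open>a = 1\<close>) and that for the series
  (\<open>a = 0\<close>).\<close>

lemma fwd_diff_linear_mult:
  fixes a s :: "'a::comm_ring_1"
  shows "fwd_diff n (\<lambda>x. (x + a) * f x) s =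
    (s + a + of_nat n) * fwd_diff n f s + of_nat n * fwd_diff (n - 1) f s"
proof (induction n arbitrary: s)
  case (Suc n)
  \<comment> \<open>The factor \<open>of_nat n\<close> covers \<open>n = 0\<close>, where
    \<open>n - 1\<close> is truncated to 0.\<close>
  have *: "of_nat n * fwd_diff n f s =
      of_nat n * fwd_diff (n - 1) f (s + 1) - of_nat n * fwd_diff (n - 1) f s"
    by (cases n) (auto simp: fwd_diff_Suc algebra_simps)
  show ?case
    unfolding fwd_diff_Suc Suc.IH using * by (simp add: algebra_simps)
qed (simp add: fwd_diff_0)

lemma fwd_diff_power_eq_0:
  fixes a s :: "'a::comm_ring_1"
  assumes "n < m"
  shows "fwd_diff m (\<lambda>x. (x + a) ^ n) s = 0"
  using assms
proof (induction n arbitrary: m s)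
  case 0
  have "fwd_diff (Suc k) (\<lambda>x. 1) s = (0::'a)" for k and s :: 'a
    by (induction k arbitrary: s) (simp add: fwd_diff_def, subst fwd_diff_Suc, simp)
  with 0 show ?case by (cases m) auto
next
  case (Suc n)
  then show ?case
    using fwd_diff_linear_mult[of m a "\<lambda>x. (x + a) ^ n" s] by simp
qed

section \<open>The recurrence for the polynomials\<close>

lemma pp_0: "pp 0 = 1"
  by (simp add: pp_def binom_poly_def fwd_diff_def)

text \<open>Both sides are expanded in the terms \<open>c \<nu>\<close>. Each gets the coefficient
  \<open>x + 1 + \<nu>\<close>, the right side as
  \<open>2 * (x + 1) - (x + 1 - \<nu>)\<close>.\<close>

lemma poly_pp_Suc: "poly (pp (Suc n)) x = (x + 1) * (2 * poly (pp n) x - poly (pp n) (x + 1))"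
proof -
  define D where "D \<nu> = fwd_diff \<nu> (\<lambda>t. (t + 1) ^ n) x" for \<nu>
  define b where "b \<nu> = (x + of_nat \<nu>) gchoose \<nu>" for \<nu>
  define c where "c \<nu> = (-1) ^ \<nu> * 2 ^ (n - \<nu>) * b \<nu> * D \<nu>" for \<nu>
  have D0: "D (Suc n) = 0"
    by (simp add: D_def fwd_diff_power_eq_0)
  \<comment> \<open>Two absorption identities return to \<open>b \<nu>\<close>, one after a shift of
    the index and one after a shift of \<open>x\<close>.\<close>
  have b_Suc: "of_nat (Suc \<nu>) * b (Suc \<nu>) = (x + of_nat \<nu> + 1) * b \<nu>" for \<nu>
    using gbinomial_absorption[of \<nu> "x + of_nat (Suc \<nu>)"] by (simp add: b_def add_ac)
  have b_shift: "(x + 1) * (x + 1 + of_nat \<nu> gchoose \<nu>) = (x + of_nat \<nu> + 1) * b \<nu>" for \<nu>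
    using gbinomial_absorb_comp[of "x + 1 + of_nat \<nu>" \<nu>] by (simp add: b_def algebra_simps)
  have "poly (pp (Suc n)) x =
      (\<Sum>\<nu>\<le>Suc n. (-1) ^ \<nu> * 2 ^ (Suc n - \<nu>) * b \<nu> * (x + 1 + of_nat \<nu>) * D \<nu>) +
      (\<Sum>\<nu>\<le>Suc n. (-1) ^ \<nu> * 2 ^ (Suc n - \<nu>) * (of_nat \<nu> * b \<nu>) * D (\<nu> - 1))"
    using fwd_diff_linear_mult[of _ 1 "\<lambda>t. (t + 1) ^ n" x]
    by (simp add: poly_pp D_def b_def sum.distrib algebra_simps)
  also have "(\<Sum>\<nu>\<le>Suc n. (-1) ^ \<nu> * 2 ^ (Suc n - \<nu>) * b \<nu> * (x + 1 + of_nat \<nu>) * D \<nu>) =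
      (\<Sum>\<nu>\<le>n. 2 * (x + 1 + of_nat \<nu>) * c \<nu>)"
    by (simp add: D0 Suc_diff_le c_def algebra_simps)
  \<comment> \<open>The factor \<open>of_nat \<nu>\<close> kills index 0, so the sum can be shifted
    by one.\<close>
  also have "(\<Sum>\<nu>\<le>Suc n. (-1) ^ \<nu> * 2 ^ (Suc n - \<nu>) * (of_nat \<nu> * b \<nu>) * D (\<nu> - 1)) =
      (\<Sum>\<nu>\<le>n. - (x + of_nat \<nu> + 1) * c \<nu>)"
    by (subst sum.atMost_Suc_shift) (simp only: b_Suc, simp add: c_def algebra_simps)
  finally have lhs: "poly (pp (Suc n)) x = (\<Sum>\<nu>\<le>n. (x + 1 + of_nat \<nu>) * c \<nu>)"
    by (simp add: algebra_simps flip: sum.distrib)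
  have "(x + 1) * poly (pp n) (x + 1) =
      (\<Sum>\<nu>\<le>n. (-1) ^ \<nu> * 2 ^ (n - \<nu>) * ((x + 1) * (x + 1 + of_nat \<nu> gchoose \<nu>)) * (D \<nu> + D (Suc \<nu>)))"
    by (simp add: poly_pp D_def fwd_diff_Suc sum_distrib_left mult_ac)
  also have "\<dots> = (\<Sum>\<nu>\<le>n. (x + of_nat \<nu> + 1) * c \<nu>) +
      (\<Sum>\<nu>\<le>n. (-1) ^ \<nu> * 2 ^ (n - \<nu>) * ((x + of_nat \<nu> + 1) * b \<nu>) * D (Suc \<nu>))"
    unfolding b_shift by (simp add: c_def algebra_simps flip: sum.distrib)
  also have "(\<Sum>\<nu>\<le>n. (-1) ^ \<nu> * 2 ^ (n - \<nu>) * ((x + of_nat \<nu> + 1) * b \<nu>) * D (Suc \<nu>)) =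
      (\<Sum>\<nu>\<le>Suc n. (-1) ^ (Suc \<nu>) * 2 ^ (Suc n - \<nu>) * (of_nat \<nu> * b \<nu>) * D \<nu>)"
    by (subst sum.atMost_Suc_shift) (simp only: b_Suc, simp)
  also have "\<dots> = (\<Sum>\<nu>\<le>n. - 2 * of_nat \<nu> * c \<nu>)"
    by (simp add: D0 Suc_diff_le c_def mult_ac)
  finally have shift: "(x + 1) * poly (pp n) (x + 1) = (\<Sum>\<nu>\<le>n. (x + 1 - of_nat \<nu>) * c \<nu>)"
    by (simp add: algebra_simps flip: sum.distrib)
  have same: "(x + 1) * poly (pp n) x = (\<Sum>\<nu>\<le>n. (x + 1) * c \<nu>)"
    by (simp add: poly_pp D_def b_def c_def sum_distrib_left)
  have "(x + 1) * (2 * poly (pp n) x - poly (pp n) (x + 1)) =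
      2 * ((x + 1) * poly (pp n) x) - (x + 1) * poly (pp n) (x + 1)"
    by (simp add: algebra_simps)
  also have "\<dots> = 2 * (\<Sum>\<nu>\<le>n. (x + 1) * c \<nu>) - (\<Sum>\<nu>\<le>n. (x + 1 - of_nat \<nu>) * c \<nu>)"
    by (simp only: shift same)
  also have "\<dots> = (\<Sum>\<nu>\<le>n. (x + 1 + of_nat \<nu>) * c \<nu>)"
    by (simp add: sum_distrib_left algebra_simps flip: sum_subtractf)
  finally show ?thesis using lhs by simp
qed

lemma pp_Suc: "pp (Suc n) = [:1, 1:] * (2 * pp n - pcompose (pp n) [:1, 1:])"
  by (rule poly_ext) (simp only: poly_mult poly_diff poly_pcompose poly_pp_Suc, simp add: add.commute)

section \<open>Integrality, leading coefficient and degree\<close>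

lemma int_coeffs_mult:
  assumes "int_coeffs p" "int_coeffs q"
  shows "int_coeffs (p * q)"
  using assms by (auto simp: int_coeffs_def coeff_mult intro!: Ints_sum Ints_mult)

lemma int_coeffs_diff: "int_coeffs p \<Longrightarrow> int_coeffs q \<Longrightarrow> int_coeffs (p - q)"
  by (auto simp: int_coeffs_def)

lemma int_coeffs_pCons: "a \<in> \<int> \<Longrightarrow> int_coeffs p \<Longrightarrow> int_coeffs (pCons a p)"
  by (auto simp: int_coeffs_def coeff_pCons split: nat.splits)

lemma int_coeffs_0: "int_coeffs 0"
  by (simp add: int_coeffs_def)

lemma int_coeffs_pcompose:
  assumes "int_coeffs p" "int_coeffs q"
  shows "int_coeffs (pcompose p q)"
  unfolding int_coeffs_def
  using assms by (auto intro!: coeff_pcompose_semiring_closed simp: int_coeffs_def)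

text \<open>The divisor is monic, so the coefficients of \<open>q\<close> are recovered from the top
  downwards without division.\<close>

lemma int_coeffs_factor:
  assumes "int_coeffs ([:a, 1:] * q)" "a \<in> \<int>"
  shows "int_coeffs q"
  unfolding int_coeffs_def
proof
  have coeff: "coeff q i = coeff ([:a, 1:] * q) (Suc i) - a * coeff q (Suc i)" for i
    by simp
  \<comment> \<open>The descent starts one place above the degree, where the coefficient is
    0.\<close>
  have *: "coeff q (degree q + 1 - k) \<in> \<int>" for k
  proof (induction k)
    case 0
    then show ?case by (simp add: coeff_eq_0)
  next
    case (Suc k)
    show ?case
    proof (cases "k \<le> degree q")
      case True
      then have "Suc (degree q + 1 - Suc k) = degree q + 1 - k" by simp
      with Suc coeff[of "degree q + 1 - Suc k"] assms show ?thesis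
        unfolding int_coeffs_def by (metis Ints_diff Ints_mult)
    qed (use Suc in simp)
  qed
  show "coeff q i \<in> \<int>" for i
    using *[of "degree q + 1 - i"] by (cases "i \<le> degree q + 1") (auto simp: coeff_eq_0)
qed

lemma pp_monic_int: "int_coeffs (pp n) \<and> lead_coeff (pp n) = 1 \<and> degree (pp n) = n"
proof (induction n)
  case 0
  show ?case by (simp add: pp_0 int_coeffs_def)
next
  case (Suc n)
  define r where "r = 2 * pp n - pcompose (pp n) [:1, 1:]"
  have lc: "coeff (pp n) n = 1" and dg: "degree (pp n) = n" and ic: "int_coeffs (pp n)"
    using Suc by auto
  have "int_coeffs [:1, 1:]" "int_coeffs 2"
    by (simp_all add: int_coeffs_pCons int_coeffs_0 numeral_poly)
  then have "int_coeffs (pp (Suc n))"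
    unfolding pp_Suc using ic by (intro int_coeffs_mult int_coeffs_diff int_coeffs_pcompose) auto
  \<comment> \<open>A shift of the argument keeps the leading coefficient, so \<open>r\<close> has
    leading coefficient 2 - 1 = 1.\<close>
  moreover have comp: "coeff (pcompose (pp n) [:1, 1:]) n = 1"
    using lead_coeff_comp[of "[:1, 1:]" "pp n"] lc dg by (simp add: degree_pcompose)
  have rn: "coeff r n = 1"
    by (simp add: r_def lc comp numeral_poly)
  have "degree r \<le> n"
    unfolding r_def using dg
    by (intro degree_diff_le) (auto simp: degree_pcompose numeral_poly)
  with rn have dr: "degree r = n"
    by (metis le_antisym le_degree zero_neq_one)
  then have "r \<noteq> 0" using rn by auto
  have "pp (Suc n) = [:1, 1:] * r" by (simp add: pp_Suc r_def)
  then have "degree (pp (Suc n)) = Suc n" "lead_coeff (pp (Suc n)) = 1"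
    using dr rn degree_mult_eq[of "[:1, 1:]" r] lead_coeff_mult[of "[:1, 1:]" r] \<open>r \<noteq> 0\<close>
    by (simp_all del: mult_pCons_left)
  ultimately show ?case by blast
qed

lemma pp_cofactor:
  assumes "pp n = [:a, 1:] * ([:b, 1:] * q)" "a \<in> \<int>" "b \<in> \<int>"
  shows "int_coeffs q \<and> lead_coeff q = 1 \<and> degree q = n - 2"
proof -
  note mon = pp_monic_int[of n]
  from mon assms have "q \<noteq> 0" by auto
  have "degree (pp n) = degree q + 2"
    using assms(1) degree_mult_eq[of "[:a, 1:]" "[:b, 1:] * q"] degree_mult_eq[of "[:b, 1:]" q] \<open>q \<noteq> 0\<close>
    by (simp del: mult_pCons_left)
  moreover have "lead_coeff (pp n) = lead_coeff q"
    unfolding assms(1) lead_coeff_mult by simp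
  moreover have "int_coeffs q"
    using mon assms int_coeffs_factor by metis
  ultimately show ?thesis using mon by auto
qed

section \<open>The exponential generating function\<close>

definition tanh_fps :: "real fps" where
  "tanh_fps = (fps_exp 2 - 1) * inverse (fps_exp 2 + 1)"

lemma fps_exp_plus_1_nonzero: "fps_exp 2 + 1 \<noteq> (0 :: real fps)"
proof
  assume "fps_exp 2 + 1 = (0 :: real fps)"
  then have "(fps_exp 2 + 1 :: real fps) $ 0 = 0" by simp
  then show False by simp
qed

lemma tanh_fps_mult: "tanh_fps * (fps_exp 2 + 1) = fps_exp 2 - 1"
proof -
  have "inverse (fps_exp 2 + 1) * (fps_exp 2 + 1) = (1 :: real fps)"
    by (intro inverse_mult_eq_1) simp
  then show ?thesis by (simp add: tanh_fps_def mult.assoc)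
qed

lemma tanh_fps_nth_0 [simp]: "tanh_fps $ 0 = 0"
  by (simp add: tanh_fps_def)

text \<open>Differentiate \<open>T * (E + 1) = E - 1\<close>, where \<open>T\<close> is
  \<open>tanh_fps\<close>, and cancel the nonzero factor \<open>E + 1\<close>.\<close>

lemma fps_deriv_tanh_fps: "fps_deriv tanh_fps = 1 - tanh_fps ^ 2"
proof -
  define E where "E = (fps_exp 2 :: real fps)"
  have dE: "fps_deriv E = 2 * E"
    by (simp add: E_def numeral_fps_const)
  have T: "tanh_fps * (E + 1) = E - 1"
    using tanh_fps_mult by (simp add: E_def)
  have "fps_deriv (tanh_fps * (E + 1)) = fps_deriv (E - 1)"
    by (simp only: T)
  then have "fps_deriv tanh_fps * (E + 1) = 2 * E - tanh_fps * (2 * E)"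
    by (simp add: dE algebra_simps)
  moreover have "(E + 1) * (tanh_fps * (E + 1)) = (E + 1) * (E - 1)"
    by (simp only: T)
  moreover have "tanh_fps * (tanh_fps * (E + 1)) = tanh_fps * (E - 1)"
    by (simp only: T)
  ultimately have "fps_deriv tanh_fps * (E + 1) = (1 - tanh_fps ^ 2) * (E + 1)"
    using T by algebra
  then show ?thesis
    using fps_exp_plus_1_nonzero by (simp add: E_def)
qed

text \<open>By the differential equation: at an odd index every product in the square of the series
  has a factor of smaller even index.\<close>

lemma tanh_fps_even: "even n \<Longrightarrow> tanh_fps $ n = 0"
proof (induction n rule: less_induct)
  case (less n)
  show ?case
  proof (cases "n = 0")
    case False
    then obtain m where n: "n = Suc m" by (cases n) auto
    with less.prems have "odd m" by simp
    have "tanh_fps $ i * tanh_fps $ (m - i) = 0" if "i \<le> m" for i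
      using less.IH[of i] less.IH[of "m - i"] that \<open>odd m\<close> n by (cases "even i") auto
    then have "(tanh_fps ^ 2) $ m = 0"
      by (subst power2_eq_square, subst fps_mult_nth, intro sum.neutral) auto
    moreover have "fps_deriv tanh_fps $ m = (1 - tanh_fps ^ 2) $ m"
      by (simp only: fps_deriv_tanh_fps)
    ultimately show ?thesis
      using n \<open>odd m\<close> by (cases m) auto
  qed simp
qed

text \<open>Compare coefficients in t tanh t = t - 2t/(e^(2t) - 1) + 4t/(e^(4t) - 1), whose
  fractions are the Bernoulli series at 2t and 4t. Since \<open>n \<ge> 1\<close>, the term t does
  not reach the index \<open>n + 1\<close>.\<close>

lemma tanh_fps_bernoulli:
  assumes "n \<ge> 1"
  shows "tanh_fps $ n = 2 ^ (n + 1) * (2 ^ (n + 1) - 1) * bernoulli_num (n + 1) / fact (n + 1)"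
proof -
  define B where "B = (fps_X / (fps_exp 1 - 1) :: real fps)"
  have "fps_exp 1 - 1 \<noteq> (0 :: real fps)"
  proof
    assume "fps_exp 1 - 1 = (0 :: real fps)"
    then have "(fps_exp 1 - 1 :: real fps) $ 1 = 0" by simp
    then show False by simp
  qed
  moreover have "subdegree (fps_exp 1 - 1 :: real fps) = 1"
    by (intro subdegreeI) auto
  ultimately have "(fps_exp 1 - 1) dvd (fps_X :: real fps)"
    by (subst fps_dvd_iff) auto
  then have B: "B * (fps_exp 1 - 1) = fps_X"
    by (simp add: B_def)
  have scaled: "(B oo (fps_const c * fps_X)) * (fps_exp c - 1) = fps_const c * fps_X" for c
  proof -
    have "(B * (fps_exp 1 - 1)) oo (fps_const c * fps_X) = fps_X oo (fps_const c * fps_X)"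
      by (simp only: B)
    then show ?thesis
      by (simp add: fps_compose_mult_distrib fps_compose_sub_distrib)
  qed
  define E where "E = (fps_exp 2 :: real fps)"
  define B2 where "B2 = B oo (fps_const 2 * fps_X)"
  define B4 where "B4 = B oo (fps_const 4 * fps_X)"
  have E4: "fps_exp 4 = E * E"
    using fps_exp_add_mult[of "2::real" 2] by (simp add: E_def)
  have T: "tanh_fps * (E + 1) = E - 1"
    using tanh_fps_mult by (simp add: E_def)
  have b2: "B2 * (E - 1) = 2 * fps_X" and b4: "B4 * (E * E - 1) = 4 * fps_X"
    using scaled[of 2] scaled[of 4] unfolding E4 by (simp_all add: B2_def B4_def E_def numeral_fps_const)
  have "E * E - 1 \<noteq> 0"
  proof
    assume "E * E - 1 = 0"
    then have "(fps_exp 4 - 1 :: real fps) $ 1 = 0" by (simp add: E4)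
    then show False by simp
  qed
  moreover have "(fps_X * tanh_fps) * (E * E - 1) = (fps_X - B2 + B4) * (E * E - 1)"
    using T b2 b4 by algebra
  ultimately have eq: "fps_X * tanh_fps = fps_X - B2 + B4" by simp
  have "tanh_fps $ n = (fps_X * tanh_fps) $ (n + 1)" by simp
  also have "\<dots> = (4 ^ (n + 1) - 2 ^ (n + 1)) * B $ (n + 1)"
    unfolding eq B2_def B4_def using assms by (simp, simp add: algebra_simps)
  also have "B $ (n + 1) = bernoulli_num (n + 1) / fact (n + 1)"
    by (simp add: bernoulli_num_def B_def)
  also have "(4::real) ^ (n + 1) = 2 ^ (n + 1) * 2 ^ (n + 1)"
    by (simp flip: power_mult_distrib)
  finally show ?thesis
    by (simp only: times_divide_eq_right right_diff_distrib mult_1_right)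
qed

text \<open>The function and the formal series both satisfy y' = 1 - y^2, so their n-th derivatives
  are the same polynomial \<open>Q\<close> in y. Both have value 0 at the origin.\<close>

lemma higher_deriv_tanh: "(deriv ^^ n) tanh (0::real) = fact n * tanh_fps $ n"
proof -
  have "\<exists>Q. (\<forall>t::real. (deriv ^^ n) tanh t = poly Q (tanh t)) \<and>
      fps_nth_deriv n tanh_fps = fps_of_poly Q oo tanh_fps"
  proof (induction n)
    case 0
    show ?case
      by (intro exI[of _ "[:0, 1:]"]) (simp add: fps_X_fps_compose_startby0)
  next
    case (Suc n)
    then obtain Q where Q: "\<And>t::real. (deriv ^^ n) tanh t = poly Q (tanh t)"
      "fps_nth_deriv n tanh_fps = fps_of_poly Q oo tanh_fps" by blast
    define R where "R = pderiv Q * [:1, 0, -1:]"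
    have "(deriv ^^ n) tanh = (\<lambda>t::real. poly Q (tanh t))"
      using Q(1) by blast
    moreover have "((\<lambda>t::real. poly Q (tanh t)) has_field_derivative poly R (tanh t)) (at t)" for t
      unfolding R_def
      by (rule DERIV_cong[OF DERIV_chain2[OF poly_DERIV]])
         (auto intro!: derivative_eq_intros simp: power2_eq_square algebra_simps)
    ultimately have "(deriv ^^ Suc n) tanh t = poly R (tanh t)" for t :: real
      by (simp add: DERIV_imp_deriv)
    moreover have "fps_nth_deriv (Suc n) tanh_fps = fps_of_poly R oo tanh_fps"
    proof -
      have 1: "fps_of_poly [:1, 0, -1:] = (1 - fps_X ^ 2 :: real fps)"
      proof -
        have "[:1, 0, -1:] = (1 - [:0, 1:] ^ 2 :: real poly)"
          by (simp add: power2_eq_square one_pCons)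
        then show ?thesis
          by (simp only: fps_of_poly_diff fps_of_poly_power fps_of_poly_1 fps_of_poly_fps_X)
      qed
      have "fps_of_poly R oo tanh_fps =
          (fps_deriv (fps_of_poly Q) oo tanh_fps) * (1 - tanh_fps ^ 2)"
        unfolding R_def fps_of_poly_mult fps_of_poly_pderiv 1
        by (simp add: fps_compose_mult_distrib fps_compose_sub_distrib fps_compose_power[symmetric]
            fps_X_fps_compose_startby0)
      also have "\<dots> = fps_deriv (fps_of_poly Q oo tanh_fps)"
        by (simp add: fps_compose_deriv fps_deriv_tanh_fps)
      finally show ?thesis
        by (simp add: fps_nth_deriv_commute Q(2) del: fps_nth_deriv.simps)
    qed
    ultimately show ?case by blast
  qed
  then obtain Q where Q: "(deriv ^^ n) tanh (0::real) = poly Q (tanh 0)"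
      "fps_nth_deriv n tanh_fps = fps_of_poly Q oo tanh_fps" by blast
  have "fact n * tanh_fps $ n = fps_nth_deriv n tanh_fps $ 0"
    by (simp add: fps_deriv_maclauren_0)
  also have "\<dots> = poly Q 0"
    by (simp add: Q poly_0_coeff_0)
  finally show ?thesis using Q(1) by simp
qed

text \<open>With u = 1 + tanh t, the differential equation reads u' = 2u - u^2. This is the
  recurrence of \<open>pp\<close> at \<open>x = k\<close>.\<close>

lemma fps_deriv_one_plus_tanh_power:
  "fps_deriv ((1 + tanh_fps) ^ Suc k) =
    of_nat (Suc k) * (2 * (1 + tanh_fps) ^ Suc k - (1 + tanh_fps) ^ Suc (Suc k))"
proof -
  have "(1 - tanh_fps ^ 2) * (1 + tanh_fps) ^ k =
      2 * (1 + tanh_fps) ^ Suc k - (1 + tanh_fps) ^ Suc (Suc k)"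
    by (simp add: algebra_simps power2_eq_square)
  moreover have "fps_deriv ((1 + tanh_fps) ^ Suc k) =
      of_nat (Suc k) * (1 - tanh_fps ^ 2) * (1 + tanh_fps) ^ k"
    using fps_deriv_power'[of "1 + tanh_fps" "Suc k"]
    by (simp add: fps_deriv_tanh_fps del: power_Suc of_nat_Suc)
  ultimately show ?thesis
    by (simp only: mult.assoc)
qed

text \<open>At natural \<open>x = k\<close> the generating function is an honest power of a series.
  The induction keeps \<open>k\<close> arbitrary because the recurrence reaches
  \<open>Suc k\<close>.\<close>

lemma poly_pp_of_nat:
  "poly (pp n) (of_nat k) = of_real (fact n * ((1 + tanh_fps) ^ Suc k) $ n)"
proof (induction n arbitrary: k)
  case 0
  show ?case by (simp add: pp_0 fps_power_zeroth)
next
  case (Suc n)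
  define G where "G k = (1 + tanh_fps) ^ Suc k" for k
  have "of_nat (Suc n) * G k $ Suc n = fps_deriv (G k) $ n"
    by simp
  also have "\<dots> = (of_nat (Suc k) * (2 * G k - G (Suc k))) $ n"
    by (simp only: G_def fps_deriv_one_plus_tanh_power)
  also have "\<dots> = of_nat (Suc k) * (2 * G k $ n - G (Suc k) $ n)"
    by (simp add: fps_of_nat[symmetric] numeral_fps_const del: of_nat_Suc)
  finally have eq: "of_nat (Suc n) * G k $ Suc n = of_nat (Suc k) * (2 * G k $ n - G (Suc k) $ n)" .
  have "fact (Suc n) * G k $ Suc n = fact n * (of_nat (Suc n) * G k $ Suc n)"
    by (simp add: algebra_simps)
  also have "\<dots> = of_nat (Suc k) * (2 * (fact n * G k $ n) - fact n * G (Suc k) $ n)"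
    unfolding eq by (simp add: algebra_simps)
  finally have "fact (Suc n) * G k $ Suc n =
      of_nat (Suc k) * (2 * (fact n * G k $ n) - fact n * G (Suc k) $ n)" .
  then show ?case
    using Suc.IH[of k] Suc.IH[of "Suc k"]
    by (simp add: poly_pp_Suc G_def add.commute)
qed

text \<open>The power series of \<open>ln (1 + tanh t)\<close>.\<close>

definition log_fps :: "real fps" where
  "log_fps = fps_integral0 (1 - tanh_fps)"

text \<open>Differentiating (1 + tanh t)^(x+1) in x multiplies it by ln (1 + tanh t).\<close>

lemma poly_pderiv_pp_of_nat:
  "poly (pderiv (pp n)) (of_nat k) = of_real (fact n * ((1 + tanh_fps) ^ Suc k * log_fps) $ n)"
proof (induction n arbitrary: k)
  case 0
  show ?case by (simp add: pp_0 log_fps_def)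
next
  case (Suc n)
  define G where "G k = (1 + tanh_fps) ^ Suc k" for k
  \<comment> \<open>The logarithmic derivative of 1 + tanh t is 1 - tanh t. The resulting term
    matches the one from differentiating the factor x + 1 in the recurrence.\<close>
  have dlog: "G k * fps_deriv log_fps = 2 * G k - G (Suc k)"
    by (simp add: log_fps_def fps_deriv_fps_integral G_def algebra_simps)
  have "fps_deriv (G k * log_fps) =
      of_nat (Suc k) * (2 * (G k * log_fps) - G (Suc k) * log_fps) + (2 * G k - G (Suc k))"
  proof -
    have "fps_deriv (G k) = of_nat (Suc k) * (2 * G k - G (Suc k))"
      by (simp only: G_def fps_deriv_one_plus_tanh_power)
    then show ?thesis
      by (simp only: fps_deriv_mult dlog) (simp add: algebra_simps)
  qed
  then have "fps_deriv (G k * log_fps) $ n =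
      of_nat (Suc k) * (2 * (G k * log_fps) $ n - (G (Suc k) * log_fps) $ n) + (2 * G k $ n - G (Suc k) $ n)"
    by (simp add: fps_of_nat[symmetric] numeral_fps_const del: of_nat_Suc fps_deriv_mult fps_deriv_nth)
  then have eq: "of_nat (Suc n) * (G k * log_fps) $ Suc n =
      of_nat (Suc k) * (2 * (G k * log_fps) $ n - (G (Suc k) * log_fps) $ n) + (2 * G k $ n - G (Suc k) $ n)"
    by (simp del: fps_deriv_mult)
  have "fact (Suc n) * (G k * log_fps) $ Suc n = fact n * (of_nat (Suc n) * (G k * log_fps) $ Suc n)"
    by (simp add: algebra_simps)
  also have "\<dots> =
      of_nat (Suc k) * (2 * (fact n * (G k * log_fps) $ n) - fact n * (G (Suc k) * log_fps) $ n) +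
      (2 * (fact n * G k $ n) - fact n * G (Suc k) $ n)"
    unfolding eq by (simp add: algebra_simps)
  finally have "fact (Suc n) * (G k * log_fps) $ Suc n =
      of_nat (Suc k) * (2 * (fact n * (G k * log_fps) $ n) - fact n * (G (Suc k) * log_fps) $ n) +
      (2 * (fact n * G k $ n) - fact n * G (Suc k) $ n)" .
  moreover have "poly (pderiv (pp (Suc n))) x = (x + 1) * (2 * poly (pderiv (pp n)) x - poly (pderiv (pp n)) (x + 1))
      + (2 * poly (pp n) x - poly (pp n) (x + 1))" for x
    unfolding pp_Suc
    by (simp add: pderiv_mult pderiv_diff pderiv_pcompose poly_pcompose pderiv_pCons add_ac del: mult_pCons_left)
  ultimately show ?case
    using Suc.IH[of k] Suc.IH[of "Suc k"] poly_pp_of_nat[of n k] poly_pp_of_nat[of n "Suc k"]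
    by (simp add: G_def add.commute)
qed

section \<open>Special values at 0 and -1\<close>

lemma poly_pp_0: "n \<ge> 1 \<Longrightarrow> poly (pp n) 0 = of_real (fact n * tanh_fps $ n)"
  using poly_pp_of_nat[of n 0] by simp

lemma poly_pp_minus_1: "n \<ge> 1 \<Longrightarrow> poly (pp n) (-1) = 0"
  by (cases n) (simp_all add: poly_pp_Suc)

text \<open>At the zero -1 of the factor x + 1 only the cofactor survives, with value
  \<open>2 * poly (pp m) (-1) - poly (pp m) 0\<close>.\<close>

lemma poly_pderiv_pp_minus_1:
  assumes "n \<ge> 2"
  shows "poly (pderiv (pp n)) (-1) = - poly (pp (n - 1)) 0"
proof -
  obtain m where n: "n = Suc m" "m \<ge> 1" using assms by (cases n) auto
  then show ?thesis
    unfolding n pp_Suc using poly_pp_minus_1[of m]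
    by (simp add: pderiv_mult pderiv_pCons poly_pcompose del: mult_pCons_left)
qed

text \<open>This is the coefficient of (1 + tanh t) ln (1 + tanh t) at an even index.\<close>

lemma poly_pderiv_pp_0:
  assumes "n \<ge> 2" "even n"
  shows "poly (pderiv (pp n)) 0 = of_nat (n - 1) * poly (pp (n - 1)) 0"
proof -
  obtain m where n: "n = Suc m" and m: "odd m" "m \<ge> 1" using assms by (cases n) auto
  have log_nth: "log_fps $ i = - (tanh_fps $ (i - 1)) / of_nat i" if "i \<ge> 2" for i
  proof (cases i)
    case (Suc j)
    then show ?thesis using that by (cases j) (simp_all add: log_fps_def field_simps)
  qed (use that in simp)
  \<comment> \<open>For odd \<open>i\<close> the index \<open>n - i\<close> is odd, where the
    logarithm has a nonzero coefficient only at 1. That coefficient is 1.\<close>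
  have "tanh_fps $ i * log_fps $ (n - i) = (if i = m then tanh_fps $ m else 0)" if "i \<le> n" for i
  proof (cases "i = m \<or> i = n \<or> even i")
    case True
    then show ?thesis using n m
      by (auto simp: tanh_fps_even log_fps_def)
  next
    case False
    then have "n - i \<ge> 2" "even (n - i - 1 )" using that n m by auto
    then show ?thesis using False by (simp add: log_nth tanh_fps_even)
  qed
  then have "(tanh_fps * log_fps) $ n = (\<Sum>i=0..n. if i = m then tanh_fps $ m else 0)"
    unfolding fps_mult_nth by (intro sum.cong) auto
  also have "\<dots> = tanh_fps $ m" using n by simp
  finally have "((1 + tanh_fps) ^ Suc 0 * log_fps) $ n = tanh_fps $ m - tanh_fps $ m / of_nat n"
    using log_nth[of n] assms n by (simp add: distrib_right)
  then have "fact n * ((1 + tanh_fps) ^ Suc 0 * log_fps) $ n = of_nat m * (fact m * tanh_fps $ m)"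
    unfolding n by (simp only: fact_Suc) (simp add: field_simps)
  moreover have "poly (pderiv (pp n)) 0 = of_real (fact n * ((1 + tanh_fps) ^ Suc 0 * log_fps) $ n)"
    using poly_pderiv_pp_of_nat[of n 0] by (simp only: of_nat_0)
  ultimately show ?thesis
    using poly_pp_0[of m] m n by (simp only:) simp
qed

section \<open>The series\<close>

definition H_coeff :: "nat \<Rightarrow> nat \<Rightarrow> real" where
  "H_coeff j m = (-1) ^ (m + 1) / 2 ^ m * fwd_diff m (\<lambda>x. x ^ j * ln x) 1"

lemma H_coeff_0 [simp]: "H_coeff j 0 = 0"
  by (simp add: H_coeff_def fwd_diff_0)

lemma H_coeff_0_eq_a_coeff: "H_coeff 0 m = a_coeff m"
  by (simp add: H_coeff_def a_coeff_def)

lemma H_coeff_Suc: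
  "H_coeff (Suc j) (Suc m) = real (m + 2) * H_coeff j (Suc m) - real (m + 1) / 2 * H_coeff j m"
  using fwd_diff_linear_mult[of "Suc m" "0::real" "\<lambda>x. x ^ j * ln x" 1]
  by (simp add: H_coeff_def field_simps)

section \<open>Growth bounds and convergence\<close>

lemma fwd_diff_inverse:
  fixes y :: real
  assumes "y > 0"
  shows "fwd_diff k inverse y = (-1) ^ k * fact k / pochhammer y (Suc k)"
  using assms
proof (induction k arbitrary: y)
  case 0
  then show ?case by (simp add: fwd_diff_0 field_simps)
next
  case (Suc k)
  \<comment> \<open>\<open>P\<close> is the common middle part of the products starting at
    \<open>y\<close> and \<open>y + 1\<close>, which differ only at their ends.\<close>
  define P where "P = pochhammer (y + 1) k"
  have "P > 0" using Suc.prems by (simp add: P_def pochhammer_pos)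
  have 1: "pochhammer (y + 1) (Suc k) = P * (y + 1 + real k)"
    by (simp add: P_def pochhammer_Suc)
  have 2: "pochhammer y (Suc k) = y * P"
    by (simp add: P_def pochhammer_rec)
  have 3: "pochhammer y (Suc (Suc k)) = y * P * (y + 1 + real k)"
    unfolding pochhammer_rec[of y "Suc k"] 1 by simp
  have "fwd_diff (Suc k) inverse y = (-1) ^ k * fact k * (1 / (P * (y + 1 + real k)) - 1 / (y * P))"
    using Suc by (simp add: fwd_diff_Suc 1 2 right_diff_distrib)
  also have "1 / (P * (y + 1 + real k)) - 1 / (y * P) = - (real k + 1) / (y * P * (y + 1 + real k))"
    using \<open>P > 0\<close> Suc.prems by (simp add: divide_simps)
  finally show ?case by (simp add: 3 algebra_simps)
qed

lemma abs_fwd_diff_inverse_le_1: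
  fixes y :: real
  assumes "y \<ge> 1"
  shows "\<bar>fwd_diff k inverse y\<bar> \<le> 1"
proof -
  have "fact k \<le> pochhammer y (Suc k)"
  proof -
    have "(fact k :: real) \<le> fact (Suc k)" by (rule fact_mono) simp
    also have "\<dots> = pochhammer 1 (Suc k)" by (simp add: pochhammer_fact)
    also have "\<dots> \<le> pochhammer y (Suc k)"
      unfolding pochhammer_prod using assms by (intro prod_mono) auto
    finally show ?thesis .
  qed
  moreover have "pochhammer y (Suc k) > 0" using assms by (intro pochhammer_pos) simp
  ultimately show ?thesis
    using assms by (simp add: fwd_diff_inverse abs_mult power_abs)
qed

text \<open>\<open>\<Delta>\<^sup>k\<^sup>+\<^sup>1 ln\<close> at \<open>1\<close> is the increment of \<open>\<Delta>\<^sup>k ln\<close> over \<open>[1, 2]\<close>; apply the mean value theorem.\<close>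

lemma abs_fwd_diff_ln_le_1: "\<bar>fwd_diff m ln (1::real)\<bar> \<le> 1"
proof (cases m)
  case 0
  then show ?thesis by (simp add: fwd_diff_0)
next
  case (Suc k)
  have "(fwd_diff k ln has_real_derivative fwd_diff k inverse y) (at y)" if "y > 0" for y :: real
    unfolding fwd_diff_def using that
    by (auto intro!: derivative_eq_intros sum.cong simp: divide_inverse)
  then obtain z :: real where z: "1 < z" "fwd_diff k ln 2 - fwd_diff k ln 1 = (2 - 1) * fwd_diff k inverse z"
    using MVT2[of 1 2 "fwd_diff k ln" "fwd_diff k inverse"] by force
  then show ?thesis
    using abs_fwd_diff_inverse_le_1[of z k] by (simp add: Suc fwd_diff_Suc)
qed

text \<open>Each use of \<open>H_coeff_Suc\<close> costs at most a factor
  \<open>2 * (m + 1)\<close>.\<close>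

lemma abs_H_coeff_le: "\<bar>H_coeff j m\<bar> \<le> 2 ^ j * real (m + 1) ^ j / 2 ^ m"
proof (induction j arbitrary: m)
  case 0
  show ?case
    using abs_fwd_diff_ln_le_1[of m] by (simp add: H_coeff_def abs_mult power_abs divide_simps)
next
  case (Suc j)
  show ?case
  proof (cases m)
    case 0
    then show ?thesis by simp
  next
    case [simp]: (Suc k)
    define M where "M = 2 ^ j * real (m + 1) ^ j / 2 ^ m"
    have "M \<ge> 0"
      by (simp add: M_def)
    have "\<bar>H_coeff j m\<bar> \<le> M"
      unfolding M_def by (rule Suc.IH)
    \<comment> \<open>The 2 lost in passing from 2^m to 2^k is compensated by the 1/2 in the
      recurrence.\<close>
    moreover have "\<bar>H_coeff j k\<bar> \<le> 2 * M"
    proof -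
      have "\<bar>H_coeff j k\<bar> \<le> 2 ^ j * real (k + 1) ^ j / 2 ^ k"
        by (rule Suc.IH)
      also have "\<dots> \<le> 2 ^ j * real (m + 1) ^ j / 2 ^ k"
        by (intro divide_right_mono mult_left_mono power_mono) auto
      finally show ?thesis by (simp add: M_def)
    qed
    ultimately have "\<bar>H_coeff (Suc j) m\<bar> \<le> real (m + 1) * M + real m / 2 * (2 * M)"
      unfolding Suc H_coeff_Suc
      by (intro order.trans[OF abs_triangle_ineq4] add_mono) (auto simp: abs_mult intro!: mult_mono)
    also have "\<dots> \<le> 2 * real (m + 1) * M"
      using \<open>M \<ge> 0\<close> by (simp add: algebra_simps)
    also have "\<dots> = 2 ^ Suc j * real (m + 1) ^ Suc j / 2 ^ m"
      unfolding M_def power_Suc times_divide_eq_right by (simp only: mult_ac)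
    finally show ?thesis .
  qed
qed

lemma poly_of_nat_bound:
  "\<exists>K d. \<forall>m. norm (poly p (of_nat m :: complex)) \<le> K * real (m + 1) ^ d"
proof (induction p)
  case 0
  show ?case by (intro exI[of _ 0]) auto
next
  case (pCons a p)
  then obtain K d where K: "\<And>m. norm (poly p (of_nat m :: complex)) \<le> K * real (m + 1) ^ d" by blast
  have "norm (poly (pCons a p) (of_nat m)) \<le> (norm a + K) * real (m + 1) ^ Suc d" for m
  proof -
    have "norm (poly (pCons a p) (of_nat m)) \<le> norm a + real m * norm (poly p (of_nat m))"
      by (simp add: norm_triangle_le norm_mult)
    also have "\<dots> \<le> norm a * real (m + 1) ^ Suc d + real (m + 1) * (K * real (m + 1) ^ d)"
    proof (intro add_mono mult_mono K)
      have "1 \<le> real (m + 1) ^ Suc d" by (rule one_le_power) simp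
      then show "norm a \<le> norm a * real (m + 1) ^ Suc d"
        using mult_left_mono[of 1 "real (m + 1) ^ Suc d" "norm a"] by simp
    qed auto
    finally show ?thesis by (simp add: algebra_simps)
  qed
  then show ?case by blast
qed

lemma summable_power_over_two_power: "summable (\<lambda>m. real (m + 1) ^ d / 2 ^ m)"
proof -
  have "(\<lambda>m. ((real m + 2) / (real m + 1)) ^ d) \<longlonglongrightarrow> 1 ^ d"
    by (intro tendsto_power) real_asymp
  \<comment> \<open>Any bound between 1 and 2 would do; halved, 3/2 gives the ratio 3/4.\<close>
  then have "eventually (\<lambda>m. ((real m + 2) / (real m + 1)) ^ d < 3 / 2) sequentially"
    by (rule order_tendstoD) simp
  then obtain N where N: "\<And>m. m \<ge> N \<Longrightarrow> ((real m + 2) / (real m + 1)) ^ d < 3 / 2"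
    by (auto simp: eventually_sequentially)
  show ?thesis
  proof (rule summable_ratio_test[of "3 / 4" N])
    fix m assume "m \<ge> N"
    have "real (Suc m + 1) ^ d / 2 ^ Suc m =
        ((real m + 2) / (real m + 1)) ^ d * (real (m + 1) ^ d / 2 ^ m) / 2"
      by (simp add: power_divide add_ac)
    also have "\<dots> \<le> 3 / 2 * (real (m + 1) ^ d / 2 ^ m) / 2"
      using N[OF \<open>m \<ge> N\<close>] by (intro divide_right_mono mult_right_mono) auto
    finally show "norm (real (Suc m + 1) ^ d / 2 ^ Suc m) \<le> 3 / 4 * norm (real (m + 1) ^ d / 2 ^ m)"
      by simp
  qed simp
qed

lemma summable_poly_H_coeff: "summable (\<lambda>m. poly p (of_nat m) * complex_of_real (H_coeff j m))"
proof -
  obtain K d where K: "\<And>m. norm (poly p (of_nat m :: complex)) \<le> K * real (m + 1) ^ d"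
    using poly_of_nat_bound by blast
  show ?thesis
  proof (rule summable_comparison_test'[of _ 0])
    show "summable (\<lambda>m. K * 2 ^ j * (real (m + 1) ^ (d + j) / 2 ^ m))"
      by (intro summable_mult summable_power_over_two_power)
    show "norm (poly p (of_nat m) * complex_of_real (H_coeff j m)) \<le> K * 2 ^ j * (real (m + 1) ^ (d + j) / 2 ^ m)" for m
      unfolding norm_mult norm_of_real
      using mult_mono[OF K abs_H_coeff_le, of m j m] order.trans[OF norm_ge_zero K[of m]]
      by (simp add: power_add mult_ac)
  qed
qed

text \<open>\<open>H_functional j p\<close> is the series of \<open>x\<^sup>j log x\<close> with weight \<open>p\<close>; the term at \<open>m = 0\<close> vanishes.\<close>

definition H_functional :: "nat \<Rightarrow> complex poly \<Rightarrow> complex" where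
  "H_functional j p = (\<Sum>m. poly p (of_nat m) * complex_of_real (H_coeff j m))"

lemma H_functional_sums:
  "(\<lambda>m. poly p (of_nat m) * complex_of_real (H_coeff j m)) sums H_functional j p"
  unfolding H_functional_def by (intro summable_sums summable_poly_H_coeff)

lemma H_functional_sums_Suc:
  "(\<lambda>m. poly p (of_nat (Suc m)) * complex_of_real (H_coeff j (Suc m))) sums H_functional j p"
  using H_functional_sums[of p j] by (subst sums_Suc_iff) simp

text \<open>Insert \<open>H_coeff_Suc\<close>. The part with \<open>H_coeff j (Suc m)\<close> has
  weight (x + 1) p(x) at x = m + 1, the part with \<open>H_coeff j m\<close> has weight (x + 1) p(x
  + 1) / 2 at x = m.\<close>

lemma H_functional_Suc:
  "H_functional (Suc j) p = H_functional j ([:1, 1:] * (2 * p - pcompose p [:1, 1:])) / 2"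
proof -
  have a: "(\<lambda>m. poly ([:1, 1:] * p) (of_nat (Suc m)) * complex_of_real (H_coeff j (Suc m))) sums
      H_functional j ([:1, 1:] * p)"
    by (rule H_functional_sums_Suc)
  have b: "(\<lambda>m. poly ([:1, 1:] * pcompose p [:1, 1:]) (of_nat m) * complex_of_real (H_coeff j m) / 2) sums
      (H_functional j ([:1, 1:] * pcompose p [:1, 1:]) / 2)"
    by (intro sums_divide H_functional_sums)
  have "(\<lambda>m. poly p (of_nat (Suc m)) * complex_of_real (H_coeff (Suc j) (Suc m))) sums
      (H_functional j ([:1, 1:] * p) - H_functional j ([:1, 1:] * pcompose p [:1, 1:]) / 2)"
    using sums_diff[OF a b]
    by (rule sums_cong[THEN iffD1, rotated])
       (simp add: H_coeff_Suc poly_pcompose field_simps)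
  then have "H_functional (Suc j) p =
      H_functional j ([:1, 1:] * p) - H_functional j ([:1, 1:] * pcompose p [:1, 1:]) / 2"
    using H_functional_sums_Suc sums_unique2 by blast
  moreover have "H_functional j ([:1, 1:] * (2 * p - pcompose p [:1, 1:])) =
      2 * H_functional j ([:1, 1:] * p) - H_functional j ([:1, 1:] * pcompose p [:1, 1:])"
  proof (rule sums_unique2[OF H_functional_sums])
    show "(\<lambda>m. poly ([:1, 1:] * (2 * p - pcompose p [:1, 1:])) (of_nat m) * complex_of_real (H_coeff j m)) sums
      (2 * H_functional j ([:1, 1:] * p) - H_functional j ([:1, 1:] * pcompose p [:1, 1:]))"
      by (rule sums_cong[THEN iffD1, OF _ sums_diff[OF sums_mult[OF H_functional_sums] H_functional_sums]])
         (simp add: algebra_simps)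
  qed
  ultimately show ?thesis by simp
qed

text \<open>Each step trades one power of x for one index of \<open>pp\<close> and a factor
  1/2.\<close>

lemma H_functional_pp: "H_functional j (pp k) = H_functional 0 (pp (k + j)) / 2 ^ j"
proof (induction j arbitrary: k)
  case (Suc j)
  have "H_functional (Suc j) (pp k) = H_functional j (pp (Suc k)) / 2"
    by (simp only: H_functional_Suc pp_Suc)
  then show ?case by (simp add: Suc.IH)
qed simp

lemma cal_H_eq: "cal_H (- of_nat n) = H_functional n 1"
proof -
  have pow: "complex_of_real x powr of_nat n = of_real (x ^ n)" if "x > 0" for x
    using that by (simp add: powr_nat')
  have "fwd_diff m (\<lambda>x::real. complex_of_real x powr of_nat n * complex_of_real (ln x)) 1 =
      of_real (fwd_diff m (\<lambda>x. x ^ n * ln x) 1)" for m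
    unfolding fwd_diff_def of_real_sum
    by (intro sum.cong refl) (subst pow, auto)
  then have "cal_H (- of_nat n) = (\<Sum>m. poly 1 (of_nat (Suc m)) * complex_of_real (H_coeff n (Suc m)))"
    by (simp add: cal_H_def H_coeff_def Let_def)
  also have "\<dots> = H_functional n 1"
    using H_functional_sums_Suc[of 1 n] by (simp add: sums_iff)
  finally show ?thesis .
qed

lemma L_star_eq: "L_star p = H_functional 0 p"
  using H_functional_sums_Suc[of p 0]
  by (simp add: sums_iff L_star_def Let_def H_coeff_0_eq_a_coeff mult.commute)

lemma cal_H_eq_L_star: "cal_H (- of_nat n) = 1 / 2 ^ n * L_star (pp n)"
  using H_functional_pp[of n 0] by (simp add: cal_H_eq L_star_eq pp_0)

text \<open>The recurrence splits off x + 1, and the cofactor \<open>r\<close> has a further root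
  \<open>c\<close>. For odd \<open>n\<close> it is -1, as both \<open>poly (pp m) (-1)\<close> and
  \<open>poly (pp m) 0\<close> vanish; for even \<open>n\<close> it is 0, as
  \<open>poly (pp n) 0\<close> vanishes and x + 1 does not.\<close>

lemma pp_factorization:
  assumes "n \<ge> 3"
  shows "\<exists>q. int_coeffs q \<and> lead_coeff q = 1 \<and> degree q = n - 2 \<and>
    (odd n \<longrightarrow> pp n = [:1, 1:] ^ 2 * q) \<and> (even n \<longrightarrow> pp n = [:0, 1:] * [:1, 1:] * q)"
proof -
  obtain m where n: "n = Suc m" and m: "m \<ge> 1" using assms by (cases n) auto
  define r where "r = 2 * pp m - pcompose (pp m) [:1, 1:]"
  have pp_n: "pp n = [:1, 1:] * r"
    by (simp add: n r_def pp_Suc)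
  define c :: complex where "c = (if odd n then -1 else 0)"
  have "poly r c = 0"
  proof (cases "odd n")
    case True
    then show ?thesis
      using poly_pp_minus_1[OF m] poly_pp_0[OF m] n
      by (simp add: c_def r_def poly_pcompose tanh_fps_even)
  next
    case False
    then have "poly (pp n) 0 = 0"
      using assms by (simp add: poly_pp_0 tanh_fps_even)
    then show ?thesis
      using False by (simp add: c_def pp_n)
  qed
  then obtain q where q: "r = [:- c, 1:] * q"
    using poly_eq_0_iff_dvd by (blast elim: dvdE)
  have "int_coeffs q \<and> lead_coeff q = 1 \<and> degree q = n - 2"
    by (rule pp_cofactor[of n 1 "- c"]) (auto simp: pp_n q c_def)
  moreover have "(odd n \<longrightarrow> pp n = [:1, 1:] ^ 2 * q) \<and> (even n \<longrightarrow> pp n = [:0, 1:] * [:1, 1:] * q)"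
    unfolding pp_n q by (simp add: c_def power2_eq_square mult.assoc mult.left_commute del: mult_pCons_left mult_pCons_right)
  ultimately show ?thesis by blast
qed

theorem theorem1p2:
  shows "(\<forall>n::nat. n \<ge> 1 \<longrightarrow> cal_H (- of_nat n) = 1 / 2 ^ n * L_star (pp n)) \<and>
    pp 1 = [:1, 1:] \<and> pp 2 = [:0, 1:] * [:1, 1:] \<and>
    (\<forall>n. n \<ge> 1 \<longrightarrow> int_coeffs (pp n) \<and> lead_coeff (pp n) = 1 \<and> degree (pp n) = n) \<and>
    (\<exists>qq :: nat \<Rightarrow> complex poly.
      (\<forall>n. n \<ge> 3 \<longrightarrow> int_coeffs (qq n) \<and> lead_coeff (qq n) = 1 \<and> degree (qq n) = n - 2) \<and>
      (\<forall>n. odd n \<and> n \<ge> 3 \<longrightarrow> pp n = [:1, 1:] ^ 2 * qq n) \<and>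
      (\<forall>n. even n \<and> n \<ge> 4 \<longrightarrow> pp n = [:0, 1:] * [:1, 1:] * qq n)) \<and>
    (\<forall>n. n \<ge> 1 \<longrightarrow>
      poly (pp n) 0 = complex_of_real ((deriv ^^ n) tanh (0::real)) \<and>
      (deriv ^^ n) tanh (0::real) =
        2 ^ (n + 1) * (2 ^ (n + 1) - 1) * (bernoulli_num (n + 1) / real (n + 1))) \<and>
    (\<forall>n. n \<ge> 2 \<longrightarrow> poly (pderiv (pp n)) (-1) = - poly (pp (n - 1)) 0) \<and>
    (\<forall>n. n \<ge> 2 \<and> even n \<longrightarrow> poly (pderiv (pp n)) 0 = of_nat (n - 1) * poly (pp (n - 1)) 0)"
proof (intro conjI allI impI)
  show pp_1: "pp 1 = [:1, 1:]"
    using pp_Suc[of 0] by (simp add: pp_0 pcompose_1)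
  show "pp 2 = [:0, 1:] * [:1, 1:]"
    using pp_Suc[of 1] pp_1 by (simp add: numeral_2_eq_2 pcompose_pCons numeral_poly)
  obtain qq where qq: "\<And>n. n \<ge> 3 \<Longrightarrow> int_coeffs (qq n) \<and> lead_coeff (qq n) = 1 \<and> degree (qq n) = n - 2 \<and>
      (odd n \<longrightarrow> pp n = [:1, 1:] ^ 2 * qq n) \<and> (even n \<longrightarrow> pp n = [:0, 1:] * [:1, 1:] * qq n)"
    using pp_factorization by metis
  show "\<exists>qq :: nat \<Rightarrow> complex poly.
      (\<forall>n. n \<ge> 3 \<longrightarrow> int_coeffs (qq n) \<and> lead_coeff (qq n) = 1 \<and> degree (qq n) = n - 2) \<and>
      (\<forall>n. odd n \<and> n \<ge> 3 \<longrightarrow> pp n = [:1, 1:] ^ 2 * qq n) \<and>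
      (\<forall>n. even n \<and> n \<ge> 4 \<longrightarrow> pp n = [:0, 1:] * [:1, 1:] * qq n)"
  proof (intro exI[of _ qq] conjI allI impI)
    fix n :: nat assume "even n \<and> n \<ge> 4"
    then have "n \<ge> 3" "even n" by auto
    then show "pp n = [:0, 1:] * [:1, 1:] * qq n" using qq by blast
  qed (use qq in blast)+
next
  fix n :: nat assume n: "n \<ge> 1"
  show "poly (pp n) 0 = complex_of_real ((deriv ^^ n) tanh (0::real))"
    using n by (simp add: poly_pp_0 higher_deriv_tanh)
  show "(deriv ^^ n) tanh (0::real) =
      2 ^ (n + 1) * (2 ^ (n + 1) - 1) * (bernoulli_num (n + 1) / real (n + 1))"
    using n by (simp add: higher_deriv_tanh tanh_fps_bernoulli del: power_Suc)
qed (use cal_H_eq_L_star pp_monic_int poly_pderiv_pp_minus_1 poly_pderiv_pp_0 in blast)+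

end
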